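(* Let $F$ be a clause set. If $F$ is satisfiable, then the reasoning algorithm with inference rules A1, A2, and A3, started from $\mathcal{S}_0=\{F\}$, yields a complete and clash-free family of clause sets (i.e. some sequence of rule applications from $\mathcal{S}_0$ ends in a complete and clash-free family).
   Context: $\mathcal{ALC}$ interpretations $\mathcal{I}=(\Delta^\mathcal{I},\cdot^\mathcal{I})$ with the standard semantics of $\lnot,\sqcap,\sqcup,\forall R.,\exists R.$. Conjunctive normal forms are defined by mutual induction: a concept literal is $A$, $\lnot A$ ($A$ a concept name), $\exists R.F$ or $\forall R.F$ ($R$ a role name, $F$ a conjunctive normal form); a clause is a finite disjunction of concept literals, represented as a set of literals; a conjunctive normal form is a finite conjunction of clauses, represented as a clause set. A clause set $F$ denotes the conjunction of its clauses, each clause the disjunction of its literals; $F$ is satisfiable if $F^\mathcal{I}\neq\emptyset$ for some interpretation $\mathcal{I}$. The complementary literal $\overline{L}$ is: $\overline{A}=\lnot A$, $\overline{\lnot A}=A$, $\overline{\exists R.F}=\forall R.\mathrm{CNF}(\lnot F)$, $\overline{\forall R.F}=\exists R.\mathrm{CNF}(\lnot F)$, with $\mathrm{CNF}(C)$ the equivalent conjunctive normal form of $C$ (push negations inward, distribute $\sqcup$ over $\sqcap$, flatten). A derivation works on families of clause sets $\mathcal{S}_i$, starting with $\mathcal{S}_0=\{F\}$; $\mathcal{S}_{i+1}$ is obtained from $\mathcal{S}_i$ by applying one of the following rules to a clause set $F\in\mathcal{S}_i$: (A1) if $L\in CL$ for a clause $CL\in F$: replace $CL$ by $\{L\}$ (nondeterministic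 choice of $L$). (A2) if $\forall R.F_1\in CL$ for some clause $CL\in F$: remove from $F$ all clauses containing $\forall R.F_1$, and replace every literal $\exists R.F_2$ occurring in clauses of $F$ by $\exists R.(F_1\cup F_2)$. (A3) if all clauses of $F$ are unit clauses of the form $\{A\}$, $\{\lnot A\}$ or $\{\exists R.F'\}$: for some $\{\exists R.F_1\}\in F$, replace $F$ by $F\setminus\{\{\exists R.F_1\}\}$ and add $F_1$ to the family ($F$ is the parent of $F_1$ with respect to $R$). A family is complete if no rule is applicable to it. It is clash-free if no clause set in it contains the empty clause or contains both $\{L\}$ and $\{\overline{L}\}$ for some literal $L$.
   Formalization: Rule A1 is taken to apply only when the clause CL is not already the unit clause {L}; without this, A1 would apply forever to any unit clause, and e.g. the satisfiable F = {{A}} would never reach a complete family. *)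

theory Defs
  imports Main "HOL-Library.FSet"
begin

section \<open>Conjunctive normal forms of ALC concepts\<close>

datatype ('c, 'r) literal =
    Pos 'c
  | Neg 'c
  | Exists 'r "('c, 'r) literal fset fset"
  | Forall 'r "('c, 'r) literal fset fset"

type_synonym ('c, 'r) clause = "('c, 'r) literal fset"
type_synonym ('c, 'r) clause_set = "('c, 'r) clause fset"


section \<open>Semantics\<close>

record ('d, 'c, 'r) interp =
  Delta :: "'d set"
  conc :: "'c \<Rightarrow> 'd set"
  role :: "'r \<Rightarrow> ('d \<times> 'd) set"

definition is_interp :: "('d, 'c, 'r) interp \<Rightarrow> bool" where
  "is_interp I \<longleftrightarrow>
     Delta I \<noteq> {} \<and> (\<forall>A. conc I A \<subseteq> Delta I) \<and> (\<forall>R. role I R \<subseteq> Delta I \<times> Delta I)"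

lemma size_fset_mem: "x |\<in>| X \<Longrightarrow> f x < size_fset f X"
  using member_le_sum[of x "fset X" "\<lambda>x. Suc (f x)"] by simp

lemma size_arg:
  "size_fset (size_fset size) F < size (Exists R F)"
  "size_fset (size_fset size) F < size (Forall R F)"
  by simp_all

function (sequential)
  lit_ext :: "('d, 'c, 'r) interp \<Rightarrow> ('c, 'r) literal \<Rightarrow> 'd set" and
  clause_ext :: "('d, 'c, 'r) interp \<Rightarrow> ('c, 'r) clause \<Rightarrow> 'd set" and
  clause_set_ext :: "('d, 'c, 'r) interp \<Rightarrow> ('c, 'r) clause_set \<Rightarrow> 'd set"
where
  "lit_ext I (Pos A) = conc I A"
| "lit_ext I (Neg A) = Delta I - conc I A"
| "lit_ext I (Exists R F) =
     {x \<in> Delta I. \<exists>y. (x, y) \<in> role I R \<and> y \<in> clause_set_ext I F}"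
| "lit_ext I (Forall R F) =
     {x \<in> Delta I. \<forall>y. (x, y) \<in> role I R \<longrightarrow> y \<in> clause_set_ext I F}"
| "clause_ext I CL = {x \<in> Delta I. fBex CL (\<lambda>L. x \<in> lit_ext I L)}"
| "clause_set_ext I F = {x \<in> Delta I. fBall F (\<lambda>CL. x \<in> clause_ext I CL)}"
  by pat_completeness auto
termination
  by (relation "measure (\<lambda>t. case t of
        Inl (_, L) \<Rightarrow> size L
      | Inr (Inl (_, CL)) \<Rightarrow> size_fset size CL
      | Inr (Inr (_, F)) \<Rightarrow> size_fset (size_fset size) F)")
    (auto simp del: size_fset_simps literal.size intro: size_fset_mem simp: size_arg)

text \<open>
  The carrier type \<open>'d\<close> of the domain cannot be quantified inside a formula, so it is an explicit
  parameter.  A hypothesis \<open>satisfiable TYPE('d) F\<close> with \<open>'d\<close> a free type variable covers models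
  over arbitrary domains.
\<close>
definition satisfiable :: "'d itself \<Rightarrow> ('c, 'r) clause_set \<Rightarrow> bool" where
  "satisfiable _ F \<longleftrightarrow>
     (\<exists>I :: ('d, 'c, 'r) interp. is_interp I \<and> clause_set_ext I F \<noteq> {})"


section \<open>Complementary literals\<close>

definition selections :: "'a fset fset \<Rightarrow> 'a fset fset" where
  "selections F =
     ffilter (\<lambda>T. \<exists>f. fBall F (\<lambda>CL. f CL |\<in>| CL) \<and> T = f |`| F) (fPow (ffUnion F))"

lemma selections_iff:
  "T |\<in>| selections F \<longleftrightarrow> (\<exists>f. fBall F (\<lambda>CL. f CL |\<in>| CL) \<and> T = f |`| F)"
  unfolding selections_def by (fastforce simp: ffUnion.rep_eq)

lemma selections_size:
  assumes "T |\<in>| selections F" "L |\<in>| T"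
  shows "size L < size_fset (size_fset size) F"
proof -
  obtain CL where "CL |\<in>| F" "L |\<in>| CL"
    using assms unfolding selections_iff by auto
  then show ?thesis
    using size_fset_mem[of L CL size] size_fset_mem[of CL F "size_fset size"] by linarith
qed

text \<open>
  \<open>cnf_neg F\<close> is \<open>CNF(\<not> F)\<close>.  Pushing the negation inward turns the conjunction \<open>F\<close> of
  disjunctions into the disjunction, over the clauses of \<open>F\<close>, of the conjunctions of the
  complements of their literals; distributing disjunction over conjunction and flattening yields
  one clause for every way of selecting a literal from each clause of \<open>F\<close>, consisting of the
  complements of the selected literals.
\<close>
context
  notes fset.map_cong [fundef_cong]
begin

function (sequential)
  compl_lit :: "('c, 'r) literal \<Rightarrow> ('c, 'r) literal" and
  cnf_neg :: "('c, 'r) clause_set \<Rightarrow> ('c, 'r) clause_set"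
where
  "compl_lit (Pos A) = Neg A"
| "compl_lit (Neg A) = Pos A"
| "compl_lit (Exists R F) = Forall R (cnf_neg F)"
| "compl_lit (Forall R F) = Exists R (cnf_neg F)"
| "cnf_neg F = (\<lambda>T. compl_lit |`| T) |`| selections F"
  by pat_completeness auto
termination
  by (relation "measure (\<lambda>t. case t of
        Inl L \<Rightarrow> size L | Inr F \<Rightarrow> size_fset (size_fset size) F)")
    (auto simp del: size_fset_simps literal.size intro: selections_size simp: size_arg)

end

declare clause_ext.simps [simp del] clause_set_ext.simps [simp del] cnf_neg.simps [simp del]

lemma ext_compl:
  assumes "is_interp I"
  shows "lit_ext I (compl_lit L) = Delta I - lit_ext I L"
    and "clause_set_ext I (cnf_neg F) = Delta I - clause_set_ext I F"
proof (induction L and F rule: compl_lit_cnf_neg.induct)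
  case (1 A)
  then show ?case using assms by simp
next
  case (2 A)
  then show ?case using assms by (auto simp: is_interp_def)
next
  case (3 R F)
  then show ?case using assms by (auto simp: is_interp_def)
next
  case (4 R F)
  then show ?case using assms by (fastforce simp: is_interp_def)
next
  case (5 F)
  have IH: "lit_ext I (compl_lit (f CL)) = Delta I - lit_ext I (f CL)"
    if "fBall F (\<lambda>CL. f CL |\<in>| CL)" "CL |\<in>| F" for f CL
    by (rule 5[of "f |`| F"]) (use that in \<open>auto simp: selections_iff\<close>)
  show ?case
  proof (intro set_eqI iffI)
    fix x assume x: "x \<in> clause_set_ext I (cnf_neg F)"
    then have xd: "x \<in> Delta I" by (simp add: clause_set_ext.simps)
    have "x \<notin> clause_set_ext I F"
    proof
      assume "x \<in> clause_set_ext I F"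
      then have "\<forall>CL. \<exists>L. CL |\<in>| F \<longrightarrow> L |\<in>| CL \<and> x \<in> lit_ext I L"
        by (auto simp: clause_set_ext.simps clause_ext.simps)
      then obtain f where f: "\<And>CL. CL |\<in>| F \<Longrightarrow> f CL |\<in>| CL \<and> x \<in> lit_ext I (f CL)"
        by metis
      then have sel: "fBall F (\<lambda>CL. f CL |\<in>| CL)" by auto
      then have "compl_lit |`| (f |`| F) |\<in>| cnf_neg F"
        unfolding cnf_neg.simps by (intro fimageI) (auto simp: selections_iff)
      then obtain CL where "CL |\<in>| F" "x \<in> lit_ext I (compl_lit (f CL))"
        using x by (fastforce simp: clause_set_ext.simps clause_ext.simps)
      then show False using IH[OF sel] f by auto
    qed
    then show "x \<in> Delta I - clause_set_ext I F" using xd by simp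
  next
    fix x assume "x \<in> Delta I - clause_set_ext I F"
    then obtain D where xd: "x \<in> Delta I" and D: "D |\<in>| F" "\<And>L. L |\<in>| D \<Longrightarrow> x \<notin> lit_ext I L"
      by (auto simp: clause_set_ext.simps clause_ext.simps)
    have "x \<in> clause_ext I CL" if CL: "CL |\<in>| cnf_neg F" for CL
    proof -
      obtain f where f: "fBall F (\<lambda>CL. f CL |\<in>| CL)" "CL = compl_lit |`| (f |`| F)"
        using CL by (auto simp: cnf_neg.simps selections_iff)
      then have "f D |\<in>| D" using D by auto
      then have "x \<in> lit_ext I (compl_lit (f D))" using IH[OF f(1) D(1)] D xd by auto
      then show ?thesis using f D xd by (auto simp: clause_ext.simps)
    qed
    then show "x \<in> clause_set_ext I (cnf_neg F)" using xd by (auto simp: clause_set_ext.simps)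
  qed
qed


section \<open>The calculus\<close>

fun add_to_exists ::
  "'r \<Rightarrow> ('c, 'r) clause_set \<Rightarrow> ('c, 'r) literal \<Rightarrow> ('c, 'r) literal"
where
  "add_to_exists R F1 (Exists R' F2) = (if R' = R then Exists R (F1 |\<union>| F2) else Exists R' F2)"
| "add_to_exists R F1 L = L"

definition unit_form :: "('c, 'r) clause \<Rightarrow> bool" where
  "unit_form CL \<longleftrightarrow>
     (\<exists>A. CL = {|Pos A|}) \<or> (\<exists>A. CL = {|Neg A|}) \<or> (\<exists>R F'. CL = {|Exists R F'|})"

text \<open>
  The side condition \<open>CL \<noteq> {|L|}\<close> of \<open>A1\<close> excludes the vacuous replacement of a unit clause by
  itself; otherwise no family with a non-empty clause would be complete.
\<close>
inductive step :: "('c, 'r) clause_set set \<Rightarrow> ('c, 'r) clause_set set \<Rightarrow> bool" where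
  A1: "\<lbrakk>F \<in> S; CL |\<in>| F; L |\<in>| CL; CL \<noteq> {|L|}\<rbrakk> \<Longrightarrow>
       step S (S - {F} \<union> {finsert {|L|} (F |-| {|CL|})})"
| A2: "\<lbrakk>F \<in> S; CL |\<in>| F; Forall R F1 |\<in>| CL\<rbrakk> \<Longrightarrow>
       step S (S - {F} \<union>
         {(\<lambda>D. add_to_exists R F1 |`| D) |`| ffilter (\<lambda>D. Forall R F1 |\<notin>| D) F})"
| A3: "\<lbrakk>F \<in> S; fBall F unit_form; {|Exists R F1|} |\<in>| F\<rbrakk> \<Longrightarrow>
       step S (S - {F} \<union> {F |-| {|{|Exists R F1|}|}, F1})"

definition complete_family :: "('c, 'r) clause_set set \<Rightarrow> bool" where
  "complete_family S \<longleftrightarrow> (\<nexists>S'. step S S')"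

definition clash_free :: "('c, 'r) clause_set set \<Rightarrow> bool" where
  "clash_free S \<longleftrightarrow>
     (\<forall>F \<in> S. {||} |\<notin>| F \<and> (\<nexists>L. {|L|} |\<in>| F \<and> {|compl_lit L|} |\<in>| F))"

end

theory Submission
  imports Defs "HOL-Library.Multiset"
begin

text \<open>
  Fix a model \<open>I\<close> of \<open>F\<close> and let it guide the derivation: \<open>A1\<close> keeps a literal that is true at
  the element witnessing the clause set, \<open>A2\<close> is applied only to a universal literal in a unit clause, and \<open>A3\<close>
  moves to a successor provided by the existential literal. In this way every clause set
  of the family stays satisfied somewhere in \<open>I\<close>, which excludes clashes. Each step replaces a
  clause set by finitely many clause sets that are smaller in the lexicographic order on
  (modal depth, number of top-level literal occurrences), so the multiset order gives termination.
\<close>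

section \<open>The termination measure: modal depth and literal count\<close>

primrec lit_depth :: "('c, 'r) literal \<Rightarrow> nat" where
  "lit_depth (Pos A) = 0"
| "lit_depth (Neg A) = 0"
| "lit_depth (Exists R F) = Suc (Max (insert 0 (\<Union>(fset ` fset (fimage (fimage lit_depth) F)))))"
| "lit_depth (Forall R F) = Suc (Max (insert 0 (\<Union>(fset ` fset (fimage (fimage lit_depth) F)))))"

text \<open>The body repeats the argument of \<open>Suc\<close> in \<open>lit_depth\<close>, where
  primitive recursion through nested finite sets calls for the double \<open>fimage\<close>. The
  \<open>insert 0\<close> covers clause sets without literals.\<close>

definition modal_depth :: "('c, 'r) clause_set \<Rightarrow> nat" where
  "modal_depth F = Max (insert 0 (\<Union>(fset ` fset (fimage (fimage lit_depth) F))))"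

lemma lit_depth_quantified [simp]:
  "lit_depth (Exists R F) = Suc (modal_depth F)"
  "lit_depth (Forall R F) = Suc (modal_depth F)"
  by (simp_all add: modal_depth_def)

declare lit_depth.simps(3,4) [simp del]

lemma modal_depth_le_iff:
  "modal_depth F \<le> n \<longleftrightarrow> (\<forall>CL. CL |\<in>| F \<longrightarrow> (\<forall>L. L |\<in>| CL \<longrightarrow> lit_depth L \<le> n))"
  unfolding modal_depth_def by (subst Max_le_iff) auto

lemma lit_depth_le_modal_depth:
  "\<lbrakk>CL |\<in>| F; L |\<in>| CL\<rbrakk> \<Longrightarrow> lit_depth L \<le> modal_depth F"
  using modal_depth_le_iff[of F "modal_depth F"] by blast

lemma modal_depth_funion: "modal_depth (F |\<union>| G) = max (modal_depth F) (modal_depth G)"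
  by (rule antisym)
    (auto simp: modal_depth_le_iff intro: lit_depth_le_modal_depth le_max_iff_disj[THEN iffD2])

text \<open>The first bound is the depth of \<open>Forall R F\<close>, which is already present when
  \<open>A2\<close> fires, so \<open>A2\<close> cannot raise the modal depth.\<close>

lemma lit_depth_add_to_exists:
  "lit_depth (add_to_exists R F L) \<le> max (Suc (modal_depth F)) (lit_depth L)"
  by (cases L) (auto simp: modal_depth_funion)

definition literal_count :: "('c, 'r) clause_set \<Rightarrow> nat" where
  "literal_count F = (\<Sum>CL\<in>fset F. fcard CL)"

lemma literal_count_fminus:
  "CL |\<in>| F \<Longrightarrow> literal_count F = fcard CL + literal_count (F |-| {|CL|})"
  unfolding literal_count_def by (simp add: sum.remove)

lemma literal_count_finsert_le: "literal_count (finsert CL F) \<le> fcard CL + literal_count F"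
  unfolding literal_count_def by (simp add: sum.insert_if)

text \<open>A map may identify clauses, or literals within a clause; both only shrink the sum. The
  two inequalities of the proof treat these effects in turn.\<close>

lemma literal_count_fimage_le:
  "literal_count ((\<lambda>D. f |`| D) |`| F) \<le> literal_count F"
proof -
  have "literal_count ((\<lambda>D. f |`| D) |`| F) \<le> (\<Sum>D\<in>fset F. fcard (f |`| D))"
    unfolding literal_count_def fimage.rep_eq by (rule sum_image_le[unfolded o_def]) auto
  also have "\<dots> \<le> literal_count F"
    unfolding literal_count_def by (intro sum_mono) (simp add: fcard.rep_eq card_image_le)
  finally show ?thesis .
qed

lemma literal_count_mono: "F |\<subseteq>| G \<Longrightarrow> literal_count F \<le> literal_count G"
  unfolding literal_count_def by (intro sum_mono2) (auto simp: less_eq_fset.rep_eq)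

lemma fcard_pos: "x |\<in>| X \<Longrightarrow> 0 < fcard X"
  by (auto simp: fcard.rep_eq card_gt_0_iff)

text \<open>Depth comes first because \<open>A3\<close> adds a filler that may have many more
  literals than its parent but is strictly less deep.\<close>

definition rank :: "('c, 'r) clause_set \<Rightarrow> nat \<times> nat" where
  "rank F = (modal_depth F, literal_count F)"

abbreviation rank_less :: "((nat \<times> nat) \<times> nat \<times> nat) set" where
  "rank_less \<equiv> less_than <*lex*> less_than"

lemma rank_lessI:
  "\<lbrakk>modal_depth G \<le> modal_depth F; literal_count G < literal_count F\<rbrakk> \<Longrightarrow>
   (rank G, rank F) \<in> rank_less"
  by (auto simp: rank_def)

lemma rank_A1:
  assumes "CL |\<in>| F" "L |\<in>| CL" "CL \<noteq> {|L|}"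
  shows "(rank (finsert {|L|} (F |-| {|CL|})), rank F) \<in> rank_less"
proof (rule rank_lessI)
  show "modal_depth (finsert {|L|} (F |-| {|CL|})) \<le> modal_depth F"
    using assms by (auto simp: modal_depth_le_iff intro: lit_depth_le_modal_depth)
  \<comment> \<open>A clause that contains \<open>L\<close> and differs from \<open>{|L|}\<close>
    has a second literal, which the choice discards.\<close>
  have "{|L|} |\<subset>| CL"
    using assms by auto
  then have "fcard {|L|} < fcard CL"
    by (rule pfsubset_fcard_mono)
  then show "literal_count (finsert {|L|} (F |-| {|CL|})) < literal_count F"
    using literal_count_fminus[OF assms(1)] literal_count_finsert_le[of "{|L|}" "F |-| {|CL|}"]
    by linarith
qed

lemma rank_A2:
  assumes "CL |\<in>| F" "Forall R F1 |\<in>| CL"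
  shows "(rank ((\<lambda>D. add_to_exists R F1 |`| D) |`| ffilter (\<lambda>D. Forall R F1 |\<notin>| D) F), rank F)
           \<in> rank_less"
    (is "(rank ?G, _) \<in> _")
proof (rule rank_lessI)
  have "lit_depth (Forall R F1) \<le> modal_depth F"
    using assms by (rule lit_depth_le_modal_depth)
  then have "lit_depth (add_to_exists R F1 L) \<le> modal_depth F" if "D |\<in>| F" "L |\<in>| D" for D L
    using lit_depth_add_to_exists[of R F1 L] lit_depth_le_modal_depth[OF that] by simp
  then show "modal_depth ?G \<le> modal_depth F"
    by (auto simp: modal_depth_le_iff)
  \<comment> \<open>At least the clause \<open>CL\<close> is deleted, and it is nonempty.\<close>
  have "literal_count ?G \<le> literal_count (F |-| {|CL|})"
    using assms by (intro order.trans[OF literal_count_fimage_le] literal_count_mono) auto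
  then show "literal_count ?G < literal_count F"
    using literal_count_fminus[OF assms(1)] fcard_pos[OF assms(2)] by linarith
qed

lemma rank_A3:
  assumes "{|Exists R F1|} |\<in>| F"
  shows "(rank (F |-| {|{|Exists R F1|}|}), rank F) \<in> rank_less" "(rank F1, rank F) \<in> rank_less"
proof -
  show "(rank (F |-| {|{|Exists R F1|}|}), rank F) \<in> rank_less"
  proof (rule rank_lessI)
    show "modal_depth (F |-| {|{|Exists R F1|}|}) \<le> modal_depth F"
      by (auto simp: modal_depth_le_iff intro: lit_depth_le_modal_depth)
    show "literal_count (F |-| {|{|Exists R F1|}|}) < literal_count F"
      using literal_count_fminus[OF assms] fcard_pos[of "Exists R F1" "{|Exists R F1|}"] by simp
  qed
  show "(rank F1, rank F) \<in> rank_less"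
    using lit_depth_le_modal_depth[OF assms, of "Exists R F1"] by (simp add: rank_def)
qed

section \<open>Rule applications guided by a model\<close>

lemma clause_set_ext_iff:
  "x \<in> clause_set_ext I F \<longleftrightarrow>
     x \<in> Delta I \<and> (\<forall>CL. CL |\<in>| F \<longrightarrow> (\<exists>L. L |\<in>| CL \<and> x \<in> lit_ext I L))"
  by (auto simp: clause_set_ext.simps clause_ext.simps)

definition atomic_unit :: "('c, 'r) clause \<Rightarrow> bool" where
  "atomic_unit CL \<longleftrightarrow> (\<exists>A. CL = {|Pos A|} \<or> CL = {|Neg A|})"

text \<open>The set \<open>N\<close> depends on \<open>F\<close> alone, so the same replacement
  works in every family containing \<open>F\<close>. Only unit universals are passed to
  \<open>A2\<close>: in a larger clause the universal literal may be false at the witness, and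
  merging its filler could destroy satisfaction.\<close>

lemma model_guided_step:
  assumes sat: "clause_set_ext I F \<noteq> {}"
    and nonatomic: "\<not> fBall F atomic_unit"
  obtains N where "finite N" "\<And>G. G \<in> N \<Longrightarrow> clause_set_ext I G \<noteq> {}"
    "\<And>G. G \<in> N \<Longrightarrow> (rank G, rank F) \<in> rank_less"
    "\<And>S. F \<in> S \<Longrightarrow> step S (S - {F} \<union> N)"
proof -
  obtain x where x: "x \<in> clause_set_ext I F"
    using sat by auto
  then have xd: "x \<in> Delta I"
    and xt: "\<And>CL. CL |\<in>| F \<Longrightarrow> \<exists>L. L |\<in>| CL \<and> x \<in> lit_ext I L"
    by (auto simp: clause_set_ext_iff)
  \<comment> \<open>If all clauses are unit and none is universal, then all have
    \<open>unit_form\<close>, and a nonatomic one must be existential.\<close>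
  consider (nonunit) CL where "CL |\<in>| F" "\<nexists>L. CL = {|L|}"
    | (universal) R F1 where "{|Forall R F1|} |\<in>| F"
    | (existential) R F1 where "fBall F unit_form" "{|Exists R F1|} |\<in>| F"
  proof (cases "(\<forall>CL. CL |\<in>| F \<longrightarrow> (\<exists>L. CL = {|L|})) \<and> (\<nexists>R F1. {|Forall R F1|} |\<in>| F)")
    case True
    have unit: "unit_form CL" if CL: "CL |\<in>| F" for CL
    proof -
      obtain L where "CL = {|L|}"
        using True CL by blast
      then show ?thesis
        using True CL by (cases L) (auto simp: unit_form_def)
    qed
    obtain CL where "CL |\<in>| F" "\<not> atomic_unit CL"
      using nonatomic by auto
    then show ?thesis
      using unit[of CL] existential unit by (auto simp: unit_form_def[of CL] atomic_unit_def)
  next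
    case False
    then show ?thesis
      using nonunit universal by blast
  qed
  then show thesis
  proof cases
    case nonunit
    obtain L where L: "L |\<in>| CL" "x \<in> lit_ext I L"
      using xt nonunit by blast
    have "CL \<noteq> {|L|}"
      using nonunit by blast
    have "x \<in> clause_set_ext I (finsert {|L|} (F |-| {|CL|}))"
      using xd xt L by (auto simp: clause_set_ext_iff)
    then show thesis
      using rank_A1[OF nonunit(1) L(1) \<open>CL \<noteq> {|L|}\<close>] step.A1[OF _ nonunit(1) L(1) \<open>CL \<noteq> {|L|}\<close>]
      by (intro that[of "{finsert {|L|} (F |-| {|CL|})}"]) auto
  next
    case universal
    let ?G = "(\<lambda>D. add_to_exists R F1 |`| D) |`| ffilter (\<lambda>D. Forall R F1 |\<notin>| D) F"
    have all: "x \<in> lit_ext I (Forall R F1)"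
      using xt[OF universal] by auto
    \<comment> \<open>By \<open>all\<close>, an \<open>R\<close>-successor of \<open>x\<close> that
      witnesses an existential literal also satisfies \<open>F1\<close>, hence the merged
      filler.\<close>
    have "x \<in> lit_ext I (add_to_exists R F1 L)" if "x \<in> lit_ext I L" for L
      using that all by (cases L) (auto simp: clause_set_ext_iff)
    then have "x \<in> clause_set_ext I ?G"
      using xd xt by (fastforce simp: clause_set_ext_iff)
    then show thesis
      using rank_A2[OF universal, of R F1] step.A2[OF _ universal, of _ R F1]
      by (intro that[of "{?G}"]) auto
  next
    case existential
    \<comment> \<open>The successor \<open>y\<close> witnesses the new clause set \<open>F1\<close>,
      while \<open>x\<close> still witnesses the remainder.\<close>
    obtain y where "y \<in> clause_set_ext I F1"
      using xt[OF existential(2)] by auto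
    moreover have "x \<in> clause_set_ext I (F |-| {|{|Exists R F1|}|})"
      using xd xt by (auto simp: clause_set_ext_iff)
    ultimately show thesis
      using rank_A3[OF existential(2)] step.A3[OF _ existential]
      by (intro that[of "{F |-| {|{|Exists R F1|}|}, F1}"]) auto
  qed
qed

section \<open>Final families, and termination by the multiset order\<close>

lemma complete_family_atomic:
  assumes "\<And>F. F \<in> S \<Longrightarrow> fBall F atomic_unit"
  shows "complete_family S"
  unfolding complete_family_def
proof
  assume "\<exists>S'. step S S'"
  then obtain S' where "step S S'" ..
  \<comment> \<open>\<open>A1\<close> needs a non-singleton clause, \<open>A2\<close> a universal
    literal and \<open>A3\<close> an existential one.\<close>
  then show False
    using assms by cases (fastforce simp: atomic_unit_def)+
qed

lemma clash_free_satisfied: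
  assumes "is_interp I" "\<And>F. F \<in> S \<Longrightarrow> clause_set_ext I F \<noteq> {}"
  shows "clash_free S"
  unfolding clash_free_def
proof (intro ballI conjI notI)
  fix F assume "F \<in> S"
  then obtain x where x: "\<And>CL. CL |\<in>| F \<Longrightarrow> \<exists>L. L |\<in>| CL \<and> x \<in> lit_ext I L"
    using assms(2) by (fastforce simp: clause_set_ext_iff)
  show False if "{||} |\<in>| F"
    using x[OF that] by simp
  show False if "\<exists>L. {|L|} |\<in>| F \<and> {|compl_lit L|} |\<in>| F"
    using that x ext_compl(1)[OF assms(1)] by fastforce
qed

text \<open>Distinct clause sets may share a rank, so ranks are collected in a multiset: one copy of
  \<open>f F\<close> gives way to finitely many smaller values.\<close>

lemma mult_replace_smaller:
  assumes "finite S" "F \<in> S" "finite N" "\<And>G. G \<in> N \<Longrightarrow> (f G, f F) \<in> r"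
  shows "(image_mset f (mset_set (S - {F} \<union> N)), image_mset f (mset_set S)) \<in> mult r"
proof -
  \<comment> \<open>Members of \<open>N\<close> may already lie in the family; removing them makes
    the union disjoint, so that \<open>mset_set\<close> turns it into a sum.\<close>
  have "S - {F} \<union> N = (S - {F}) \<union> (N - (S - {F}))"
    by blast
  then have new: "mset_set (S - {F} \<union> N) = mset_set (S - {F}) + mset_set (N - (S - {F}))"
    using assms by (metis Diff_disjoint finite_Diff mset_set_Union)
  have "mset_set S = mset_set (S - {F}) + {#F#}"
    using assms by (simp add: mset_set.remove)
  then show ?thesis
    unfolding new
    using one_step_implies_mult[of "image_mset f {#F#}" "image_mset f (mset_set (N - (S - {F})))" r
        "image_mset f (mset_set (S - {F}))"] assms(3,4)
    by simp
qed

text \<open>Well-founded induction on the multiset of ranks: as long as some clause set is not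
  atomic, a model-guided step lowers this multiset and keeps the family finite and satisfied in
  \<open>I\<close>.\<close>

lemma satisfied_family_completes:
  assumes I: "is_interp I"
    and "finite S" "\<And>F. F \<in> S \<Longrightarrow> clause_set_ext I F \<noteq> {}"
  shows "\<exists>S'. step\<^sup>*\<^sup>* S S' \<and> complete_family S' \<and> clash_free S'"
proof -
  have "wf (inv_image (mult rank_less) (\<lambda>S. image_mset rank (mset_set S)))"
    by (intro wf_inv_image wf_mult wf_lex_prod wf_less_than)
  then show ?thesis
    using assms(2,3)
  proof (induction S rule: wf_induct_rule)
    case (less S)
    show ?case
    proof (cases "\<forall>F\<in>S. fBall F atomic_unit")
      case True
      then show ?thesis
        using complete_family_atomic[of S] clash_free_satisfied[OF I less.prems(2)] by blast
    next
      case False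
      then obtain F where F: "F \<in> S" "\<not> fBall F atomic_unit"
        by blast
      obtain N where N: "finite N" "\<And>G. G \<in> N \<Longrightarrow> clause_set_ext I G \<noteq> {}"
        "\<And>G. G \<in> N \<Longrightarrow> (rank G, rank F) \<in> rank_less"
        "\<And>S. F \<in> S \<Longrightarrow> step S (S - {F} \<union> N)"
        using model_guided_step[OF less.prems(2)[OF F(1)] F(2)] by metis
      have "\<exists>S'. step\<^sup>*\<^sup>* (S - {F} \<union> N) S' \<and> complete_family S' \<and> clash_free S'"
      proof (rule less.IH)
        show "(S - {F} \<union> N, S) \<in> inv_image (mult rank_less) (\<lambda>S. image_mset rank (mset_set S))"
          using mult_replace_smaller[of S F N rank rank_less] less.prems(1) F(1) N(1,3)
          by (simp add: inv_image_def)
      qed (use less.prems N in auto)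
      then show ?thesis
        using N(4)[OF F(1)] by (meson converse_rtranclp_into_rtranclp)
    qed
  qed
qed

theorem mainTheorem4:
  fixes F :: "('c, 'r) clause_set"
  assumes "satisfiable TYPE('d) F"
  shows "\<exists>S. step\<^sup>*\<^sup>* {F} S \<and> complete_family S \<and> clash_free S"
proof -
  obtain I :: "('d, 'c, 'r) interp" where "is_interp I" "clause_set_ext I F \<noteq> {}"
    using assms by (auto simp: satisfiable_def)
  then show ?thesis
    by (intro satisfied_family_completes) auto
qed

end
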